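(* Let $G$ be a graph with $n$ vertices and $m$ edges including $k$ internal edges. Assume $G$ does not contain isolated vertices nor $P_2$ as a component. Let $t'$ be the number of components of $G$ isomorphic to $P_3$, and let $$\beta(G) = \left\lfloor\min \left\{ (3 + 2\sqrt{2})(m -n)+(1 + \sqrt{2})\left(m +\tfrac{1}{2}\right), \ 2m + 5(k-t') +1 \right\} \right\rfloor.$$ Then $\tau(G)\leq\beta(G)$. Moreover, if $\tau(G)=\beta(G)$, then for every non-negative integer $t$, the graph $G\cup tP_3$ is antimagic if and only if $t\leq\tau(G)$.
   Context: Graphs are finite and simple, not necessarily connected. For a graph $G$ with $m$ edges and a bijection $f: E(G)\to\{1,2,\dots,m\}$, let $\phi_f(v)$ be the sum of $f(e)$ over all edges $e$ incident to the vertex $v$. The bijection $f$ is an antimagic labeling of $G$ if $\phi_f(u)\neq\phi_f(v)$ for all pairs of distinct vertices $u,v$; $G$ is antimagic if it admits an antimagic labeling. $P_j$ denotes the path on $j$ vertices. $G\cup H$ denotes the disjoint union of $G$ and $H$, and $tG$ the disjoint union of $t$ copies of $G$. An edge is internal if both of its ends are non-leaf vertices; otherwise it is pendant. If $G$ is antimagic, $\tau(G)$ is the maximum non-negative integer $t$ such that $G\cup t'P_3$ is antimagic for all integers $0\leq t'\leq t$; if $G$ is not antimagic, $\tau(G)=-\infty$. *)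

theory Defs
  imports Complex_Main "HOL-Library.Extended_Real"
begin

datatype 'a graph = Graph (verts: "'a set") (edges: "'a set set")

definition simple_graph :: "'a graph \<Rightarrow> bool" where
  "simple_graph G \<longleftrightarrow> finite (verts G) \<and> (\<forall>e\<in>edges G. e \<subseteq> verts G \<and> card e = 2)"

definition incident_edges :: "'a graph \<Rightarrow> 'a \<Rightarrow> 'a set set" where
  "incident_edges G v = {e \<in> edges G. v \<in> e}"

definition vdegree :: "'a graph \<Rightarrow> 'a \<Rightarrow> nat" where
  "vdegree G v = card (incident_edges G v)"

definition isolated :: "'a graph \<Rightarrow> 'a \<Rightarrow> bool" where
  "isolated G v \<longleftrightarrow> v \<in> verts G \<and> vdegree G v = 0"

definition leaf :: "'a graph \<Rightarrow> 'a \<Rightarrow> bool" where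
  "leaf G v \<longleftrightarrow> v \<in> verts G \<and> vdegree G v = 1"

definition internal_edges :: "'a graph \<Rightarrow> 'a set set" where
  "internal_edges G = {e \<in> edges G. \<forall>v\<in>e. \<not> leaf G v}"

definition vertex_sum :: "'a graph \<Rightarrow> ('a set \<Rightarrow> nat) \<Rightarrow> 'a \<Rightarrow> nat" where
  "vertex_sum G f v = (\<Sum>e\<in>incident_edges G v. f e)"

definition antimagic_labeling :: "'a graph \<Rightarrow> ('a set \<Rightarrow> nat) \<Rightarrow> bool" where
  "antimagic_labeling G f \<longleftrightarrow>
     bij_betw f (edges G) {1..card (edges G)} \<and> inj_on (vertex_sum G f) (verts G)"

definition antimagic :: "'a graph \<Rightarrow> bool" where
  "antimagic G \<longleftrightarrow> (\<exists>f. antimagic_labeling G f)"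

definition path_graph :: "nat \<Rightarrow> nat graph" where
  "path_graph j = Graph {..<j} {{i, Suc i} |i. Suc i < j}"

definition graph_union :: "'a graph \<Rightarrow> 'b graph \<Rightarrow> ('a + 'b) graph" (infixr "\<uplus>\<^sub>G" 65) where
  "G \<uplus>\<^sub>G H = Graph (verts G <+> verts H) ((`) Inl ` edges G \<union> (`) Inr ` edges H)"

definition copies :: "nat \<Rightarrow> 'a graph \<Rightarrow> (nat \<times> 'a) graph" where
  "copies t G = Graph ({..<t} \<times> verts G) (\<Union>i<t. (`) (Pair i) ` edges G)"

definition graph_iso :: "'a graph \<Rightarrow> 'b graph \<Rightarrow> bool" (infix "\<cong>\<^sub>G" 50) where
  "G \<cong>\<^sub>G H \<longleftrightarrow> (\<exists>h. bij_betw h (verts G) (verts H) \<and>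
     (\<forall>u\<in>verts G. \<forall>v\<in>verts G. {u, v} \<in> edges G \<longleftrightarrow> {h u, h v} \<in> edges H))"

definition connectivity :: "'a graph \<Rightarrow> ('a \<times> 'a) set" where
  "connectivity G = {(u, v). {u, v} \<in> edges G}\<^sup>* \<inter> verts G \<times> verts G"

definition induced_subgraph :: "'a graph \<Rightarrow> 'a set \<Rightarrow> 'a graph" where
  "induced_subgraph G W = Graph W {e \<in> edges G. e \<subseteq> W}"

definition components :: "'a graph \<Rightarrow> 'a graph set" where
  "components G = induced_subgraph G ` (verts G // connectivity G)"

text \<open>
  For an antimagic graph the supremum ranges over a nonempty, downward closed set of naturals,
  so it is the maximum when the set is bounded; it is \<open>\<infinity>\<close> when no maximum exists, so a finite
  upper bound on \<open>\<tau>\<close> includes the claim that the maximum exists.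
\<close>
definition tau :: "'a graph \<Rightarrow> ereal" ("\<tau>") where
  "\<tau> G = (if antimagic G
          then (SUP t\<in>{t. \<forall>s\<le>t. antimagic (G \<uplus>\<^sub>G copies s (path_graph 3))}. ereal (real t))
          else -\<infinity>)"

definition beta :: "'a graph \<Rightarrow> int" ("\<beta>") where
  "\<beta> G =
    (let n = real (card (verts G)); m = real (card (edges G));
         k = real (card (internal_edges G));
         t' = real (card {C \<in> components G. C \<cong>\<^sub>G path_graph 3})
     in \<lfloor>min ((3 + 2 * sqrt 2) * (m - n) + (1 + sqrt 2) * (m + 1 / 2))
             (2 * m + 5 * (k - t') + 1)\<rfloor>)"

end

theory Submission
  imports Defs
begin

text \<open>
  Both bounds come from one antimagic labeling \<open>f\<close> of \<open>H = G \<uplus> t P\<^sub>3\<close>, a graph with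
  \<open>M = m + 2 t\<close> edges and \<open>N = n + 3 t\<close> vertices, and both compare a sum of distinct
  vertex sums with a sum of distinct labels.

  For the first bound, the \<open>N\<close> vertex sums are distinct and positive, so they add up to at
  least \<open>N (N + 1) / 2\<close>. They also add up to \<open>M (M + 1)\<close>, because every label is counted at
  both ends of its edge. Hence \<open>N (N + 1) \<le> 2 M (M + 1)\<close> (\<open>antimagic_card_verts_bound\<close>).
  Completing the squares gives \<open>N + 1/2 \<le> \<surd>2 (M + 1/2)\<close>, which is linear in \<open>t\<close>, and the
  coefficient \<open>3 - 2 \<surd>2\<close> of \<open>t\<close> is positive with inverse \<open>3 + 2 \<surd>2\<close>.

  For the second bound, consider the centres of the components of \<open>H\<close> isomorphic to \<open>P\<^sub>3\<close>;
  there are at least \<open>t + t'\<close> of them. If the sum of a centre is at most \<open>M\<close>, it is the label of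
  some edge. That edge is not pendant, since the label of a pendant edge is already the sum of
  a leaf. So all but at most \<open>k\<close> of the centres have sums above \<open>M\<close>. If there are \<open>s\<close> such
  centres, their sums are at least \<open>M + 1, \<dots>, M + s\<close> in total, yet they use \<open>2 s\<close> distinct labels
  from \<open>{1..M}\<close>, which add up to at most \<open>M + (M - 1) + \<dots> + (M - 2 s + 1)\<close>. This forces
  \<open>5 s \<le> 2 M + 1\<close> (\<open>antimagic_p3_centres_bound\<close>).

  Thus every \<open>t\<close> with \<open>G \<uplus> t P\<^sub>3\<close> antimagic, and not only every \<open>t \<le> \<tau> G\<close>, is at most \<open>\<beta> G\<close>.
  This is why equality \<open>\<tau> G = \<beta> G\<close> leaves no antimagic \<open>G \<uplus> t P\<^sub>3\<close> beyond \<open>\<tau> G\<close>.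
\<close>

section \<open>Sums of distinct integers\<close>

lemma sum_distinct_ints_ge:
  fixes S :: "int set"
  assumes "finite S" "\<forall>x\<in>S. L < x"
  shows "2 * int (card S) * L + int (card S) * (int (card S) + 1) \<le> 2 * \<Sum>S"
  using assms
proof (induction S rule: finite_linorder_max_induct)
  case empty
  then show ?case by simp
next
  case (insert b A)
  have "insert b A \<subseteq> {L<..b}"
    using insert.hyps insert.prems by (auto intro: less_imp_le)
  hence "card (insert b A) \<le> card {L<..b}"
    by (intro card_mono) auto
  moreover have "b \<notin> A" using insert.hyps by blast
  ultimately have "int (card A) + 1 + L \<le> b"
    using insert.hyps insert.prems by auto
  moreover have "2 * int (card A) * L + int (card A) * (int (card A) + 1) \<le> 2 * \<Sum>A"
    using insert by auto
  ultimately show ?case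
    using insert.hyps \<open>b \<notin> A\<close> by (simp add: algebra_simps)
qed

lemma sum_distinct_ints_le:
  fixes S :: "int set"
  assumes "finite S" "\<forall>x\<in>S. x \<le> U"
  shows "2 * \<Sum>S \<le> 2 * int (card S) * (U + 1) - int (card S) * (int (card S) + 1)"
proof -
  have "\<Sum>(uminus ` S) = - \<Sum>S"
    by (subst sum.reindex) (auto simp: sum_negf)
  moreover have "card (uminus ` S) = card S"
    by (rule card_image) auto
  moreover have "\<forall>x\<in>uminus ` S. - (U + 1) < x" using assms(2) by auto
  ultimately show ?thesis
    using sum_distinct_ints_ge[of "uminus ` S" "- (U + 1)"] assms(1) by (simp add: algebra_simps)
qed

section \<open>Two counting bounds for antimagic graphs\<close>

lemma finite_edges: "simple_graph G \<Longrightarrow> finite (edges G)"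
  unfolding simple_graph_def by (meson Pow_iff finite_Pow_iff finite_subset subsetI)

lemma finite_incident_edges: "simple_graph G \<Longrightarrow> finite (incident_edges G v)"
  using finite_edges[of G] by (simp add: incident_edges_def)

lemma sum_vertex_sums:
  assumes "simple_graph G"
  shows "(\<Sum>v\<in>verts G. vertex_sum G f v) = 2 * (\<Sum>e\<in>edges G. f e)"
proof -
  have fin: "finite (verts G)" "finite (edges G)"
    using assms finite_edges by (auto simp: simple_graph_def)
  have "(\<Sum>v\<in>verts G. vertex_sum G f v) = (\<Sum>e\<in>edges G. \<Sum>v | v \<in> verts G \<and> v \<in> e. f e)"
    unfolding vertex_sum_def incident_edges_def by (rule sum.swap_restrict[OF fin])
  also have "\<dots> = (\<Sum>e\<in>edges G. 2 * f e)"
  proof (rule sum.cong[OF refl])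
    fix e assume "e \<in> edges G"
    hence "{v. v \<in> verts G \<and> v \<in> e} = e" "card e = 2"
      using assms by (auto simp: simple_graph_def)
    thus "(\<Sum>v | v \<in> verts G \<and> v \<in> e. f e) = 2 * f e" by simp
  qed
  finally show ?thesis by (simp add: sum_distrib_left)
qed

lemma antimagic_card_verts_bound:
  assumes G: "simple_graph G" and iso: "\<nexists>v. isolated G v" and "antimagic G"
  shows "int (card (verts G)) * (int (card (verts G)) + 1)
    \<le> 2 * (int (card (edges G)) * (int (card (edges G)) + 1))"
proof -
  obtain f where f: "antimagic_labeling G f" using assms by (auto simp: antimagic_def)
  define M where "M = card (edges G)"
  have bij: "bij_betw f (edges G) {1..M}" and inj: "inj_on (vertex_sum G f) (verts G)"
    using f by (auto simp: antimagic_labeling_def M_def)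
  have fin: "finite (verts G)" using G by (simp add: simple_graph_def)
  let ?\<phi> = "\<lambda>v. int (vertex_sum G f v)"
  have inj': "inj_on ?\<phi> (verts G)" using inj by (auto simp: inj_on_def)
  have pos: "0 < vertex_sum G f v" if "v \<in> verts G" for v
  proof -
    have "incident_edges G v \<noteq> {}"
      using iso that by (auto simp: isolated_def vdegree_def)
    then obtain e where e: "e \<in> incident_edges G v" by blast
    hence "f e \<in> {1..M}"
      using bij_betwE[OF bij] by (auto simp: incident_edges_def)
    moreover have "f e \<le> vertex_sum G f v"
      unfolding vertex_sum_def using e finite_incident_edges[OF G] by (intro member_le_sum) auto
    ultimately show ?thesis by simp
  qed
  have "(\<Sum>v\<in>verts G. vertex_sum G f v) = 2 * \<Sum>{1..M}"
    using sum_vertex_sums[OF G, of f] sum.reindex_bij_betw[OF bij, of "\<lambda>x. x"] by simp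
  also have "\<dots> = M * (M + 1)"
    using gauss_sum_from_Suc_0[of M, where 'a = nat] by simp
  finally have "(\<Sum>v\<in>verts G. ?\<phi> v) = int (M * (M + 1))"
    by (metis of_nat_sum)
  hence "\<Sum>(?\<phi> ` verts G) = int M * (int M + 1)"
    using sum.reindex[OF inj', of "\<lambda>x. x"] by (simp add: algebra_simps)
  moreover have "\<forall>x\<in>?\<phi> ` verts G. 0 < x" using pos by auto
  ultimately show ?thesis
    using sum_distinct_ints_ge[of "?\<phi> ` verts G" 0] fin card_image[OF inj'] by (simp add: M_def)
qed

text \<open>
  The centre of a component isomorphic to \<open>P\<^sub>3\<close>, expressed through degrees, so that counting such
  vertices does not involve connectivity. A leaf on an edge at \<open>c\<close> is never \<open>c\<close> itself, since
  \<open>c\<close> has degree 2.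
\<close>
definition p3_centre :: "'a graph \<Rightarrow> 'a \<Rightarrow> bool" where
  "p3_centre G c \<longleftrightarrow>
     c \<in> verts G \<and> vdegree G c = 2 \<and> (\<forall>e\<in>incident_edges G c. \<exists>v\<in>e. leaf G v)"

lemma p3_centres_share_no_edge:
  assumes "simple_graph G" "p3_centre G c" "p3_centre G d" "c \<noteq> d"
  shows "incident_edges G c \<inter> incident_edges G d = {}"
proof (rule ccontr)
  assume "\<not> ?thesis"
  then obtain e where e: "e \<in> edges G" "c \<in> e" "d \<in> e" "e \<in> incident_edges G c"
    by (auto simp: incident_edges_def)
  hence "card e = 2" using assms(1) by (auto simp: simple_graph_def)
  hence "e = {c, d}" using e assms(4) by (auto simp: card_2_iff)
  moreover obtain v where "v \<in> e" "leaf G v" using assms(2) e(4) by (auto simp: p3_centre_def)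
  ultimately show False using assms(2,3) by (auto simp: p3_centre_def leaf_def)
qed

text \<open>
  A centre whose sum is a label competes with the end of the edge that carries this label: were
  the edge pendant, its leaf would have the same sum.
\<close>
lemma small_p3_centre_sum_is_internal_label:
  assumes f: "antimagic_labeling G f" and c: "p3_centre G c"
    and sum: "vertex_sum G f c \<in> f ` edges G"
  shows "vertex_sum G f c \<in> f ` internal_edges G"
proof -
  obtain e where e: "e \<in> edges G" "vertex_sum G f c = f e" using sum by auto
  have "\<not> leaf G v" if "v \<in> e" for v
  proof
    assume v: "leaf G v"
    hence "card (incident_edges G v) = 1" by (simp add: leaf_def vdegree_def)
    moreover have "e \<in> incident_edges G v" using e(1) that by (simp add: incident_edges_def)
    ultimately have "incident_edges G v = {e}" by (metis card_1_singletonE singletonD)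
    hence "vertex_sum G f v = vertex_sum G f c" by (simp add: vertex_sum_def[of G f v] e(2))
    hence "v = c"
      using f v c by (auto simp: antimagic_labeling_def leaf_def p3_centre_def inj_on_def)
    thus False using v c by (auto simp: leaf_def p3_centre_def)
  qed
  thus ?thesis using e by (auto simp: internal_edges_def)
qed

lemma antimagic_p3_centres_bound:
  assumes G: "simple_graph G" and "antimagic G"
  shows "5 * (int (card {c. p3_centre G c}) - int (card (internal_edges G)))
    \<le> 2 * int (card (edges G)) + 1"
proof -
  obtain f where f: "antimagic_labeling G f" using assms by (auto simp: antimagic_def)
  define M where "M = card (edges G)"
  define D where "D = {c. p3_centre G c}"
  define low where "low = {c\<in>D. vertex_sum G f c \<le> M}"
  define high where "high = {c\<in>D. M < vertex_sum G f c}"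
  define E where "E = (\<Union>c\<in>high. incident_edges G c)"
  have bij: "bij_betw f (edges G) {1..M}" and inj: "inj_on (vertex_sum G f) (verts G)"
    using f by (auto simp: antimagic_labeling_def M_def)
  have finE: "finite (edges G)" using G by (rule finite_edges)
  have DV: "D \<subseteq> verts G" by (auto simp: D_def p3_centre_def)
  have finD: "finite D" using DV G by (auto simp: simple_graph_def intro: finite_subset)
  have inj_edges: "inj_on f (edges G)" and img: "f ` edges G = {1..M}"
    using bij by (auto simp: bij_betw_def)

  have "vertex_sum G f ` low \<subseteq> f ` internal_edges G"
  proof
    fix x assume "x \<in> vertex_sum G f ` low"
    then obtain c where c: "x = vertex_sum G f c" "p3_centre G c" "x \<le> M"
      by (auto simp: low_def D_def)
    have "incident_edges G c \<noteq> {}" using c(2) by (auto simp: p3_centre_def vdegree_def)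
    then obtain e where e: "e \<in> incident_edges G c" by blast
    have "f e \<le> x"
      unfolding c(1) vertex_sum_def using e finite_incident_edges[OF G]
      by (intro member_le_sum) auto
    moreover have "1 \<le> f e" using e img by (force simp: incident_edges_def)
    ultimately have "x \<in> f ` edges G" using c(3) img by simp
    thus "x \<in> f ` internal_edges G"
      using small_p3_centre_sum_is_internal_label[OF f c(2)] c(1) by simp
  qed
  moreover have finI: "finite (internal_edges G)" using finE by (simp add: internal_edges_def)
  ultimately have "card (vertex_sum G f ` low) \<le> card (internal_edges G)"
    by (meson card_image_le card_mono finite_imageI le_trans)
  moreover have "inj_on (vertex_sum G f) low"
    using inj DV by (auto simp: low_def intro: inj_on_subset)
  ultimately have low: "card low \<le> card (internal_edges G)" by (simp add: card_image)

  have fin_high: "finite high" using finD by (simp add: high_def)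
  have disj: "\<forall>c\<in>high. \<forall>d\<in>high. c \<noteq> d \<longrightarrow> incident_edges G c \<inter> incident_edges G d = {}"
    using p3_centres_share_no_edge[OF G] by (auto simp: high_def D_def)
  have fin_inc: "\<forall>c\<in>high. finite (incident_edges G c)"
    using finite_incident_edges[OF G] by blast
  have "card E = (\<Sum>c\<in>high. card (incident_edges G c))"
    unfolding E_def by (rule card_UN_disjoint[OF fin_high fin_inc disj])
  also have "\<dots> = (\<Sum>c\<in>high. 2)"
    by (rule sum.cong) (auto simp: high_def D_def p3_centre_def vdegree_def)
  finally have cardE: "card E = 2 * card high" by simp
  have sumE: "(\<Sum>c\<in>high. vertex_sum G f c) = (\<Sum>e\<in>E. f e)"
    unfolding E_def vertex_sum_def by (rule sum.UNION_disjoint[OF fin_high fin_inc disj, symmetric])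

  let ?\<phi> = "\<lambda>v. int (vertex_sum G f v)" and ?f = "\<lambda>e. int (f e)"
  have E_sub: "E \<subseteq> edges G" by (auto simp: E_def incident_edges_def)
  have injf: "inj_on ?f E"
    using inj_edges E_sub by (auto simp: inj_on_def)
  have inj\<phi>: "inj_on ?\<phi> high"
    using inj DV by (auto simp: inj_on_def high_def)
  have "2 * int (card high) * int M + int (card high) * (int (card high) + 1) \<le> 2 * (\<Sum>c\<in>high. ?\<phi> c)"
  proof -
    have "\<forall>x\<in>?\<phi> ` high. int M < x" by (auto simp: high_def)
    thus ?thesis
      using sum_distinct_ints_ge[of "?\<phi> ` high" "int M"] fin_high
        sum.reindex[OF inj\<phi>, of "\<lambda>x. x"] card_image[OF inj\<phi>] by simp
  qed
  also have "(\<Sum>c\<in>high. ?\<phi> c) = (\<Sum>e\<in>E. ?f e)"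
    using sumE by (metis of_nat_sum)
  also have "2 * \<dots> \<le> 2 * int (card E) * (int M + 1) - int (card E) * (int (card E) + 1)"
  proof -
    have "\<forall>x\<in>?f ` E. x \<le> int M" using img E_sub by fastforce
    thus ?thesis
      using sum_distinct_ints_le[of "?f ` E" "int M"] finE E_sub
        sum.reindex[OF injf, of "\<lambda>x. x"] card_image[OF injf] finite_subset by fastforce
  qed
  finally have "int (card high) * (5 * int (card high)) \<le> int (card high) * (2 * int M + 1)"
    by (simp add: cardE algebra_simps)
  hence high: "5 * int (card high) \<le> 2 * int M + 1"
    by (cases "card high = 0") auto

  have "D = low \<union> high" by (auto simp: low_def high_def)
  hence "card D \<le> card low + card high" by (simp add: card_Un_le)
  thus ?thesis using low high by (simp add: M_def D_def)
qed

section \<open>Embeddings onto unions of components\<close>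

text \<open>
  An isomorphism of \<open>K\<close> with a union of components of \<open>H\<close>: the edges of \<open>H\<close> that meet the image
  are exactly the images of edges of \<open>K\<close>. Degrees, leaves and centres are therefore
  preserved. The inclusion of \<open>G\<close> into \<open>G \<uplus> t P\<^sub>3\<close>, the inclusion of each copy of \<open>P\<^sub>3\<close>, and the
  inverse of an isomorphism between a component and \<open>P\<^sub>3\<close> are all of this kind.
\<close>
definition component_embedding :: "('b \<Rightarrow> 'a) \<Rightarrow> 'b graph \<Rightarrow> 'a graph \<Rightarrow> bool" where
  "component_embedding j K H \<longleftrightarrow> inj_on j (verts K) \<and> j ` verts K \<subseteq> verts H \<and>
     (\<forall>v\<in>verts K. incident_edges H (j v) = (`) j ` incident_edges K v)"

lemma component_embedding_vdegree:
  assumes "component_embedding j K H" "simple_graph K" "v \<in> verts K"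
  shows "vdegree H (j v) = vdegree K v"
proof -
  have "incident_edges K v \<subseteq> Pow (verts K)"
    using assms(2) by (auto simp: simple_graph_def incident_edges_def)
  hence "inj_on ((`) j) (incident_edges K v)"
    using assms(1) inj_on_subset[OF inj_on_image_Pow] by (auto simp: component_embedding_def)
  thus ?thesis
    using assms by (simp add: component_embedding_def vdegree_def card_image)
qed

lemma component_embedding_leaf:
  assumes "component_embedding j K H" "simple_graph K" "v \<in> verts K"
  shows "leaf H (j v) \<longleftrightarrow> leaf K v"
  using assms component_embedding_vdegree[OF assms]
  by (auto simp: leaf_def component_embedding_def)

lemma component_embedding_p3_centre:
  assumes j: "component_embedding j K H" and K: "simple_graph K" and c: "p3_centre K c"
  shows "p3_centre H (j c)"
proof -
  have cK: "c \<in> verts K" using c by (simp add: p3_centre_def)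
  have "\<exists>v\<in>e. leaf H v" if "e \<in> incident_edges H (j c)" for e
  proof -
    have "e \<in> (`) j ` incident_edges K c"
      using that j cK by (simp add: component_embedding_def)
    then obtain e' where e': "e' \<in> incident_edges K c" "e = j ` e'" by blast
    then obtain v where v: "v \<in> e'" "leaf K v" using c by (auto simp: p3_centre_def)
    hence "leaf H (j v)"
      using component_embedding_leaf[OF j K] by (auto simp: leaf_def)
    thus ?thesis using e' v by auto
  qed
  thus ?thesis
    using j c cK component_embedding_vdegree[OF j K cK]
    by (auto simp: p3_centre_def component_embedding_def)
qed

lemma equiv_connectivity: "equiv (verts G) (connectivity G)"
proof (rule equivI)
  have "sym {(u, v). {u, v} \<in> edges G}" by (auto simp: sym_def insert_commute)
  hence "sym ({(u, v). {u, v} \<in> edges G}\<^sup>*)" by (rule sym_rtrancl)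
  thus "sym (connectivity G)" by (auto simp: connectivity_def sym_def)
  show "trans (connectivity G)" by (auto simp: connectivity_def trans_def)
qed (auto simp: connectivity_def refl_on_def)

lemma components_disjoint:
  assumes "C \<in> components G" "C' \<in> components G" "v \<in> verts C" "v \<in> verts C'"
  shows "C = C'"
proof -
  obtain W W' where W: "W \<in> verts G // connectivity G" "C = induced_subgraph G W"
    and W': "W' \<in> verts G // connectivity G" "C' = induced_subgraph G W'"
    using assms(1,2) by (auto simp: components_def)
  hence "v \<in> W \<inter> W'" using assms(3,4) by (simp add: induced_subgraph_def)
  hence "W = W'" using quotient_disj[OF equiv_connectivity W(1) W'(1)] by blast
  thus ?thesis using W W' by simp
qed

lemma component_edge_closed:
  assumes G: "simple_graph G" and W: "W \<in> verts G // connectivity G"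
    and e: "e \<in> edges G" "v \<in> e" "v \<in> W"
  shows "e \<subseteq> W"
proof
  fix w assume w: "w \<in> e"
  have "card e = 2" "e \<subseteq> verts G" using G e(1) by (auto simp: simple_graph_def)
  hence "v = w \<or> e = {v, w}" using e w by (auto simp: card_2_iff)
  hence "(v, w) \<in> connectivity G"
    using \<open>e \<subseteq> verts G\<close> e w by (auto simp: connectivity_def)
  thus "w \<in> W"
    by (rule in_quotient_imp_closed[OF equiv_connectivity W e(3)])
qed

text \<open>
  An isomorphism only speaks about edges inside the component. It determines all incident edges
  because no edge of \<open>G\<close> leaves a component.
\<close>
lemma component_iso_embedding:
  assumes G: "simple_graph G" and K: "simple_graph K"
    and C: "C \<in> components G" "C \<cong>\<^sub>G K"
  obtains j where "component_embedding j K G" "j ` verts K = verts C"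
proof -
  obtain W where W: "W \<in> verts G // connectivity G" "C = induced_subgraph G W"
    using C(1) by (auto simp: components_def)
  have vC: "verts C = W" and eC: "edges C = {e \<in> edges G. e \<subseteq> W}"
    by (auto simp: W(2) induced_subgraph_def)
  have WG: "W \<subseteq> verts G"
    using in_quotient_imp_subset[OF equiv_connectivity W(1)] .
  obtain h where h: "bij_betw h W (verts K)"
    and adj: "\<And>u v. u \<in> W \<Longrightarrow> v \<in> W \<Longrightarrow> {u, v} \<in> edges C \<longleftrightarrow> {h u, h v} \<in> edges K"
    using C(2) by (auto simp: graph_iso_def vC)
  define j where "j = inv_into W h"
  have j: "bij_betw j (verts K) W" unfolding j_def by (rule bij_betw_inv_into[OF h])
  have jh: "j (h w) = w" if "w \<in> W" for w
    unfolding j_def by (rule bij_betw_inv_into_left[OF h that])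
  have hj: "h (j v) = v" if "v \<in> verts K" for v
    unfolding j_def by (rule bij_betw_inv_into_right[OF h that])
  have jW: "j v \<in> W" if "v \<in> verts K" for v using j that by (rule bij_betw_apply)
  have hK: "h w \<in> verts K" if "w \<in> W" for w using h that by (rule bij_betw_apply)
  have "incident_edges G (j v) = (`) j ` incident_edges K v" if v: "v \<in> verts K" for v
  proof (intro set_eqI iffI)
    fix e assume "e \<in> incident_edges G (j v)"
    hence e: "e \<in> edges G" "j v \<in> e" by (auto simp: incident_edges_def)
    have eW: "e \<subseteq> W" by (rule component_edge_closed[OF G W(1) e jW[OF v]])
    have "card e = 2" using G e(1) by (auto simp: simple_graph_def)
    then obtain w where w: "e = {j v, w}" using e(2) by (auto simp: card_2_iff)
    hence "{v, h w} \<in> edges K"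
      using adj[of "j v" w] e(1) eW hj[OF v] by (auto simp: eC)
    hence "{v, h w} \<in> incident_edges K v" by (simp add: incident_edges_def)
    moreover have "e = j ` {v, h w}" using w jh eW by auto
    ultimately show "e \<in> (`) j ` incident_edges K v" by blast
  next
    fix e assume "e \<in> (`) j ` incident_edges K v"
    then obtain e' where e': "e = j ` e'" "e' \<in> edges K" "v \<in> e'"
      by (auto simp: incident_edges_def)
    have "card e' = 2" "e' \<subseteq> verts K" using K e'(2) by (auto simp: simple_graph_def)
    then obtain w where w: "e' = {v, w}" "w \<in> verts K" using e'(3) by (auto simp: card_2_iff)
    hence "{j v, j w} \<in> edges C"
      using adj[OF jW jW] v e'(2) hj by auto
    thus "e \<in> incident_edges G (j v)"
      using e' w by (auto simp: eC incident_edges_def)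
  qed
  hence "component_embedding j K G"
    using j WG by (auto simp: component_embedding_def bij_betw_def)
  moreover have "j ` verts K = verts C" using j by (simp add: bij_betw_def vC)
  ultimately show thesis by (rule that)
qed

section \<open>Adding copies of the path on three vertices\<close>

lemma path_graph_3:
  "verts (path_graph 3) = {0, 1, 2}" "edges (path_graph 3) = {{0, 1}, {1, 2}}"
proof -
  have "{{i, Suc i} |i. Suc i < 3} = (\<lambda>i. {i, Suc i}) ` {..<2}" by auto
  also have "{..<2 :: nat} = {0, 1}" by auto
  also have "(\<lambda>i. {i, Suc i}) ` {0, 1} = {{0, 1}, {1, 2}}" by (simp add: numeral_2_eq_2)
  finally have "{{i, Suc i} |i. Suc i < 3} = {{0, 1}, {1, 2 :: nat}}" .
  moreover have "{..<3 :: nat} = {0, 1, 2}" by auto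
  ultimately show "verts (path_graph 3) = {0, 1, 2}" "edges (path_graph 3) = {{0, 1}, {1, 2}}"
    by (simp_all add: path_graph_def)
qed

lemma simple_path_graph_3: "simple_graph (path_graph 3)"
  by (auto simp: simple_graph_def path_graph_3)

lemma incident_edges_path_graph_3:
  "incident_edges (path_graph 3) 0 = {{0, 1}}"
  "incident_edges (path_graph 3) 1 = {{0, 1}, {1, 2}}"
  "incident_edges (path_graph 3) 2 = {{1, 2}}"
  by (auto simp: incident_edges_def path_graph_3)

lemma vdegree_path_graph_3:
  "vdegree (path_graph 3) 0 = 1" "vdegree (path_graph 3) 1 = 2" "vdegree (path_graph 3) 2 = 1"
  by (simp_all add: vdegree_def incident_edges_path_graph_3 doubleton_eq_iff del: One_nat_def)

lemma leaf_path_graph_3: "leaf (path_graph 3) 0" "leaf (path_graph 3) 2"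
  using vdegree_path_graph_3 by (auto simp: leaf_def path_graph_3)

lemma p3_centre_path_graph_3: "p3_centre (path_graph 3) 1"
  unfolding p3_centre_def incident_edges_path_graph_3
  using vdegree_path_graph_3(2) leaf_path_graph_3 by (simp add: path_graph_3(1))

lemma card_P3_components_le:
  assumes G: "simple_graph G"
  shows "card {C \<in> components G. C \<cong>\<^sub>G path_graph 3} \<le> card {c. p3_centre G c}"
proof -
  let ?P = "{C \<in> components G. C \<cong>\<^sub>G path_graph 3}"
  have "\<exists>c. c \<in> verts C \<and> p3_centre G c" if C: "C \<in> ?P" for C
  proof -
    obtain j where j: "component_embedding j (path_graph 3) G" "j ` verts (path_graph 3) = verts C"
      by (rule component_iso_embedding[OF G simple_path_graph_3]) (use C in auto)
    have "p3_centre G (j 1)"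
      by (rule component_embedding_p3_centre[OF j(1) simple_path_graph_3 p3_centre_path_graph_3])
    moreover have "j 1 \<in> verts C" using j(2) by (auto simp: path_graph_3)
    ultimately show ?thesis by blast
  qed
  then obtain g where g: "\<And>C. C \<in> ?P \<Longrightarrow> g C \<in> verts C \<and> p3_centre G (g C)" by metis
  have "inj_on g ?P"
    by (rule inj_onI) (metis (no_types, lifting) g components_disjoint mem_Collect_eq)
  moreover have "g ` ?P \<subseteq> {c. p3_centre G c}" using g by blast
  moreover have "finite {c. p3_centre G c}"
    using G by (auto simp: simple_graph_def p3_centre_def)
  ultimately show ?thesis by (rule card_inj_on_le)
qed

abbreviation add_P3s :: "'a graph \<Rightarrow> nat \<Rightarrow> ('a + nat \<times> nat) graph" where
  "add_P3s G t \<equiv> G \<uplus>\<^sub>G copies t (path_graph 3)"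

lemma verts_add_P3s:
  "verts (add_P3s G t) = Inl ` verts G \<union> (\<Union>i<t. (\<lambda>v. Inr (i, v)) ` verts (path_graph 3))"
  by (auto simp: graph_union_def copies_def)

lemma edges_add_P3s:
  "edges (add_P3s G t)
    = (`) Inl ` edges G \<union> (\<Union>i<t. (`) (\<lambda>v. Inr (i, v)) ` edges (path_graph 3))"
  by (simp add: graph_union_def copies_def image_UN image_image)

lemma simple_graph_add_P3s:
  assumes "simple_graph G"
  shows "simple_graph (add_P3s G t)"
proof -
  have "card (Inl ` e) = 2" if "e \<in> edges G" for e
    using assms that by (simp add: card_image simple_graph_def)
  moreover have "card ((\<lambda>v. Inr (i, v)) ` e) = 2"
    if "e \<in> edges (path_graph 3)" for i :: nat and e
    using simple_path_graph_3 that by (subst card_image) (auto simp: inj_on_def simple_graph_def)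
  moreover have "finite (verts G)" "finite (verts (path_graph 3))"
    using assms simple_path_graph_3 by (auto simp: simple_graph_def)
  moreover have "\<forall>e\<in>edges G. e \<subseteq> verts G" "\<forall>e\<in>edges (path_graph 3). e \<subseteq> verts (path_graph 3)"
    using assms simple_path_graph_3 by (auto simp: simple_graph_def)
  ultimately show ?thesis
    unfolding simple_graph_def verts_add_P3s edges_add_P3s by fast
qed

lemma component_embedding_Inl: "component_embedding Inl G (add_P3s G t)"
  unfolding component_embedding_def incident_edges_def edges_add_P3s verts_add_P3s by auto

lemma component_embedding_Inr:
  assumes "i < t"
  shows "component_embedding (\<lambda>v. Inr (i, v)) (path_graph 3) (add_P3s G t)"
  using assms unfolding component_embedding_def incident_edges_def edges_add_P3s verts_add_P3s
  by (auto simp: inj_on_def)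

lemma card_add_P3s:
  assumes G: "simple_graph G"
  shows "card (verts (add_P3s G t)) = card (verts G) + 3 * t"
    and "card (edges (add_P3s G t)) = card (edges G) + 2 * t"
proof -
  have fin: "finite (verts G)" "finite (edges G)"
    using G finite_edges by (auto simp: simple_graph_def)
  have "card (Inr ` ({..<t} \<times> {0, 1, 2 :: nat}) :: ('a + nat \<times> nat) set) = 3 * t"
    by (simp add: card_image card_cartesian_product)
  moreover have "verts (add_P3s G t) = Inl ` verts G \<union> Inr ` ({..<t} \<times> {0, 1, 2})"
    by (auto simp: verts_add_P3s path_graph_3)
  ultimately show "card (verts (add_P3s G t)) = card (verts G) + 3 * t"
    using fin by (simp only:) (subst card_Un_disjoint, auto simp: card_image)
  let ?E = "\<lambda>i. (`) (\<lambda>v. Inr (i, v) :: 'a + nat \<times> nat) ` edges (path_graph 3)"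
  have E: "?E i = {{Inr (i, 0), Inr (i, 1)}, {Inr (i, 1), Inr (i, 2)}}" for i
    by (simp add: path_graph_3)
  have "card (?E i) = 2" for i
    unfolding E by (simp add: doubleton_eq_iff)
  moreover have "?E i \<inter> ?E k = {}" if "i \<noteq> k" for i k
    unfolding E using that by (simp add: doubleton_eq_iff)
  moreover have "finite (?E i)" for i by (simp add: path_graph_3)
  ultimately have "card (\<Union>i<t. ?E i) = 2 * t"
    by (subst card_UN_disjoint) auto
  moreover have "card ((`) (Inl :: 'a \<Rightarrow> 'a + nat \<times> nat) ` edges G) = card (edges G)"
    by (rule card_image) (auto simp: inj_on_def inj_image_eq_iff)
  moreover have "(`) Inl ` edges G \<inter> (\<Union>i<t. ?E i) = {}"
  proof -
    have "Inl ` e \<noteq> {Inr p, Inr q}" for e :: "'a set" and p q :: "nat \<times> nat" by blast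
    thus ?thesis unfolding E by blast
  qed
  moreover have "finite (\<Union>i<t. ?E i)" by (simp add: path_graph_3)
  ultimately show "card (edges (add_P3s G t)) = card (edges G) + 2 * t"
    unfolding edges_add_P3s using fin by (subst card_Un_disjoint) auto
qed

lemma no_isolated_add_P3s:
  assumes G: "simple_graph G" and iso: "\<nexists>v. isolated G v"
  shows "\<nexists>v. isolated (add_P3s G t) v"
proof
  assume "\<exists>v. isolated (add_P3s G t) v"
  then obtain v where v: "v \<in> verts (add_P3s G t)" "vdegree (add_P3s G t) v = 0"
    by (auto simp: isolated_def)
  show False
  proof (cases v)
    case (Inl u)
    hence "u \<in> verts G" using v(1) by (auto simp: verts_add_P3s)
    thus False
      using component_embedding_vdegree[OF component_embedding_Inl G, of u t] v iso Inl
      by (auto simp: isolated_def)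
  next
    case (Inr p)
    obtain i w where p: "p = (i, w)" by (cases p)
    hence w: "i < t" "w \<in> verts (path_graph 3)" using v(1) Inr by (auto simp: verts_add_P3s)
    hence "vdegree (path_graph 3) w = 0"
      using component_embedding_vdegree[OF component_embedding_Inr simple_path_graph_3, of i t w G] v Inr p
      by simp
    thus False using w(2) vdegree_path_graph_3 by (auto simp: path_graph_3)
  qed
qed

lemma card_internal_edges_add_P3s_le:
  assumes G: "simple_graph G"
  shows "card (internal_edges (add_P3s G t)) \<le> card (internal_edges G)"
proof -
  have "internal_edges (add_P3s G t) \<subseteq> (`) Inl ` internal_edges G"
  proof
    fix e assume "e \<in> internal_edges (add_P3s G t)"
    hence e: "e \<in> edges (add_P3s G t)" "\<And>v. v \<in> e \<Longrightarrow> \<not> leaf (add_P3s G t) v"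
      by (auto simp: internal_edges_def)
    from e(1) consider (old) e' where "e' \<in> edges G" "e = Inl ` e'"
      | (new) i e' where "i < t" "e' \<in> edges (path_graph 3)" "e = (\<lambda>v. Inr (i, v)) ` e'"
      by (auto simp: edges_add_P3s)
    thus "e \<in> (`) Inl ` internal_edges G"
    proof cases
      case old
      hence "e' \<subseteq> verts G" using G by (auto simp: simple_graph_def)
      hence "\<not> leaf G v" if "v \<in> e'" for v
        using component_embedding_leaf[OF component_embedding_Inl G, of v t] e(2) old that by auto
      thus ?thesis using old by (auto simp: internal_edges_def)
    next
      case new
      \<comment> \<open>Both edges of \<open>P\<^sub>3\<close> are pendant.\<close>
      have "0 \<in> e' \<or> 2 \<in> e'" using new(2) by (auto simp: path_graph_3)
      then obtain v where v: "v \<in> e'" "leaf (path_graph 3) v" using leaf_path_graph_3 by blast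
      hence "leaf (add_P3s G t) (Inr (i, v))"
        using component_embedding_leaf[OF component_embedding_Inr[OF new(1)] simple_path_graph_3, of v G]
        by (auto simp: leaf_def)
      thus ?thesis using e(2) new v by auto
    qed
  qed
  moreover have "finite (internal_edges G)"
    using finite_edges[OF G] by (simp add: internal_edges_def)
  ultimately show ?thesis by (meson surj_card_le)
qed

lemma card_p3_centres_add_P3s_ge:
  assumes G: "simple_graph G"
  shows "card {c. p3_centre G c} + t \<le> card {c. p3_centre (add_P3s G t) c}"
proof -
  have fin: "finite {c. p3_centre H c}" if "simple_graph H" for H :: "'b graph"
    using that by (auto simp: simple_graph_def p3_centre_def)
  let ?old = "Inl ` {c. p3_centre G c} :: ('a + nat \<times> nat) set"
    and ?new = "(\<lambda>i. Inr (i, 1)) ` {..<t} :: ('a + nat \<times> nat) set"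
  have "card ?old = card {c. p3_centre G c}" by (simp add: card_image)
  moreover have "card ?new = t" by (subst card_image) (auto simp: inj_on_def)
  ultimately have "card (?old \<union> ?new) = card {c. p3_centre G c} + t"
    using fin[OF G] by (subst card_Un_disjoint) auto
  moreover have "?old \<subseteq> {c. p3_centre (add_P3s G t) c}"
    using component_embedding_p3_centre[OF component_embedding_Inl G] by auto
  moreover have "?new \<subseteq> {c. p3_centre (add_P3s G t) c}"
    using component_embedding_p3_centre
        [OF component_embedding_Inr simple_path_graph_3 p3_centre_path_graph_3] by auto
  ultimately show ?thesis
    using card_mono[OF fin[OF simple_graph_add_P3s[OF G]], of "?old \<union> ?new" t] by simp
qed

section \<open>The bound on the number of added paths\<close>

text \<open>
  The inequality between \<open>N = n + 3 t\<close> and \<open>M = m + 2 t\<close> is quadratic, but becomes linear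
  after completing squares, as \<open>2 N (N + 1) = 2 (N + 1/2)\<^sup>2 - 1/2\<close> and likewise for \<open>M\<close>.
\<close>
lemma quadratic_bound_linearised:
  fixes m n t :: real
  assumes "0 \<le> m" "0 \<le> t"
    and "(n + 3 * t) * (n + 3 * t + 1) \<le> 2 * ((m + 2 * t) * (m + 2 * t + 1))"
  shows "t \<le> (3 + 2 * sqrt 2) * (m - n) + (1 + sqrt 2) * (m + 1 / 2)"
proof -
  have "(n + 3 * t + 1/2)\<^sup>2 \<le> (sqrt 2 * (m + 2 * t + 1/2))\<^sup>2"
    using assms(3) by (simp add: power2_eq_square algebra_simps)
  hence "n + 3 * t + 1/2 \<le> sqrt 2 * (m + 2 * t + 1/2)"
    by (rule power2_le_imp_le) (use assms in simp)
  hence "(3 - 2 * sqrt 2) * t \<le> sqrt 2 * (m + 1/2) - n - 1/2"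
    by (simp add: algebra_simps)
  hence "(3 + 2 * sqrt 2) * ((3 - 2 * sqrt 2) * t)
      \<le> (3 + 2 * sqrt 2) * (sqrt 2 * (m + 1/2) - n - 1/2)"
    by (intro mult_left_mono) auto
  thus ?thesis by (simp add: algebra_simps)
qed

lemma antimagic_add_P3s_le_beta:
  assumes G: "simple_graph G" and iso: "\<nexists>v. isolated G v" and anti: "antimagic (add_P3s G t)"
  shows "int t \<le> \<beta> G"
proof -
  define n where "n = card (verts G)"
  define m where "m = card (edges G)"
  define k where "k = card (internal_edges G)"
  define t' where "t' = card {C \<in> components G. C \<cong>\<^sub>G path_graph 3}"
  have "(int n + 3 * int t) * (int n + 3 * int t + 1)
      \<le> 2 * ((int m + 2 * int t) * (int m + 2 * int t + 1))"
    using antimagic_card_verts_bound[OF simple_graph_add_P3s[OF G] no_isolated_add_P3s[OF G iso] anti]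
    by (simp add: card_add_P3s[OF G] n_def m_def)
  hence "(real n + 3 * real t) * (real n + 3 * real t + 1)
      \<le> 2 * ((real m + 2 * real t) * (real m + 2 * real t + 1))"
    by (subst (asm) of_int_le_iff[where 'a = real, symmetric]) simp
  hence 1: "real t \<le> (3 + 2 * sqrt 2) * (real m - real n) + (1 + sqrt 2) * (real m + 1 / 2)"
    by (intro quadratic_bound_linearised) auto
  have "5 * (int t' + int t - int k) \<le> 2 * (int m + 2 * int t) + 1"
    using antimagic_p3_centres_bound[OF simple_graph_add_P3s[OF G] anti]
      card_internal_edges_add_P3s_le[OF G, of t] card_p3_centres_add_P3s_ge[OF G, of t]
      card_P3_components_le[OF G] card_add_P3s(2)[OF G, of t]
    by (simp add: m_def k_def t'_def)
  hence "int t \<le> 2 * int m + 5 * (int k - int t') + 1" by (simp add: algebra_simps)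
  hence 2: "real t \<le> 2 * real m + 5 * (real k - real t') + 1"
    by (subst (asm) of_int_le_iff[where 'a = real, symmetric]) simp
  show ?thesis
    using 1 2 by (simp add: beta_def Let_def le_floor_iff n_def m_def k_def t'_def)
qed

theorem corollary2:
  fixes G :: "'a graph"
  assumes "simple_graph G"
    and "\<nexists>v. isolated G v"
    and "\<nexists>C. C \<in> components G \<and> C \<cong>\<^sub>G path_graph 2"
  shows "\<tau> G \<le> ereal (real_of_int (\<beta> G)) \<and>
    (\<tau> G = ereal (real_of_int (\<beta> G)) \<longrightarrow>
      (\<forall>t::nat. antimagic (G \<uplus>\<^sub>G copies t (path_graph 3)) \<longleftrightarrow> ereal (real t) \<le> \<tau> G))"
proof (intro conjI impI allI)
  let ?T = "{t. \<forall>s\<le>t. antimagic (add_P3s G s)}"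
  have le: "real t \<le> real_of_int (\<beta> G)" if "antimagic (add_P3s G t)" for t
    using antimagic_add_P3s_le_beta[OF assms(1,2) that] by linarith
  show "\<tau> G \<le> ereal (real_of_int (\<beta> G))"
    unfolding tau_def by (auto intro!: SUP_least le)
  fix t :: nat
  assume eq: "\<tau> G = ereal (real_of_int (\<beta> G))"
  hence tau: "\<tau> G = (SUP t\<in>?T. ereal (real t))" by (auto simp: tau_def split: if_splits)
  show "antimagic (add_P3s G t) \<longleftrightarrow> ereal (real t) \<le> \<tau> G"
  proof
    assume "antimagic (add_P3s G t)"
    thus "ereal (real t) \<le> \<tau> G" using le eq by simp
  next
    assume t: "ereal (real t) \<le> \<tau> G"
    show "antimagic (add_P3s G t)"
    proof (rule ccontr)
      assume "\<not> antimagic (add_P3s G t)"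
      \<comment> \<open>For \<open>t = 0\<close> the set is empty, and the bound \<open>-1\<close> on its supremum is still valid.\<close>
      hence less: "u < t" if "u \<in> ?T" for u using that by (auto simp: not_le[symmetric])
      have "ereal (real u) \<le> ereal (real t - 1)" if "u \<in> ?T" for u
        using less[OF that] by simp
      hence "\<tau> G \<le> ereal (real t - 1)" unfolding tau by (rule SUP_least)
      hence "ereal (real t) \<le> ereal (real t - 1)" using t by (rule order_trans[rotated])
      thus False by simp
    qed
  qed
qed

end
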